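(* Let $1\le k\le n$ be integers and let $t\in(0,1)$ be fixed (nonrandom). Suppose that $(p_i,H_i)$, $i=1,\ldots,n$, are i.i.d. as $(p,H)$, where $H\in\{0,1\}$, $\Pr(H=0)=\pi_0=1-\Pr(H=1)$, and $\Pr(p\le u\mid H)=(1-H)u+HF_1(u)$ for $u\in(0,1)$, for some cdf $F_1$. Then, for the single-step test that rejects each $H_i=0$ if and only if $p_i\le t$, $$k\text{-FDR}_n(t)\le \Pr\{V_{n-1}(t)\ge k-1\}\;\mathrm{FDR}_n(t).$$
   Context: There are $n$ null hypotheses; $H_i=0$ means the $i$th null hypothesis is true and $H_i=1$ means it is false; $p_i$ is a $p$-value (taking values in $[0,1]$) for the $i$th null hypothesis. $I(A)$ is the indicator of the event $A$. For every integer $m\ge 0$, with $(p_i,H_i)$ i.i.d. from the model, $$V_m(t)=\sum_{i=1}^m I(p_i\le t,\,H_i=0),\qquad R_m(t)=\sum_{i=1}^m I(p_i\le t),$$ so that $V_{n-1}(t)$ is the analogous count based on $n-1$ of the pairs. The error rates are $$k\text{-FDR}_n(t)=E\left\{\frac{V_n(t)\,I(V_n(t)\ge k)}{\max(R_n(t),1)}\right\},\qquad \mathrm{FDR}_n(t)=E\left\{\frac{V_n(t)}{\max(R_n(t),1)}\right\}.$$ *)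

theory Defs
  imports "HOL-Probability.Probability"
begin

(* The pairs (p_i, H_i) are indexed from 1; H i \<omega> = 0 means that the i-th null hypothesis is true. *)

definition V :: "(nat \<Rightarrow> 'a \<Rightarrow> real) \<Rightarrow> (nat \<Rightarrow> 'a \<Rightarrow> nat) \<Rightarrow> nat \<Rightarrow> real \<Rightarrow> 'a \<Rightarrow> nat" where
  "V p H m t \<omega> = (\<Sum>i=1..m. of_bool (p i \<omega> \<le> t \<and> H i \<omega> = 0))"

definition R :: "(nat \<Rightarrow> 'a \<Rightarrow> real) \<Rightarrow> nat \<Rightarrow> real \<Rightarrow> 'a \<Rightarrow> nat" where
  "R p m t \<omega> = (\<Sum>i=1..m. of_bool (p i \<omega> \<le> t))"

definition kFDR :: "'a measure \<Rightarrow> (nat \<Rightarrow> 'a \<Rightarrow> real) \<Rightarrow> (nat \<Rightarrow> 'a \<Rightarrow> nat) \<Rightarrow> nat \<Rightarrow> nat \<Rightarrow> real \<Rightarrow> real" where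
  "kFDR M p H k n t =
     (\<integral>\<omega>. real (V p H n t \<omega>) * of_bool (V p H n t \<omega> \<ge> k) / real (max (R p n t \<omega>) 1) \<partial>M)"

definition FDR :: "'a measure \<Rightarrow> (nat \<Rightarrow> 'a \<Rightarrow> real) \<Rightarrow> (nat \<Rightarrow> 'a \<Rightarrow> nat) \<Rightarrow> nat \<Rightarrow> real \<Rightarrow> real" where
  "FDR M p H n t = (\<integral>\<omega>. real (V p H n t \<omega>) / real (max (R p n t \<omega>) 1) \<partial>M)"

(* A version of the conditional probability of the event P given a discrete random variable X,
   i.e. given the sigma-algebra generated by X; determined up to null sets only. *)
definition cond_prob_given :: "'a measure \<Rightarrow> ('a \<Rightarrow> 'b) \<Rightarrow> ('a \<Rightarrow> bool) \<Rightarrow> 'a \<Rightarrow> real" where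
  "cond_prob_given M X P =
     real_cond_exp M (vimage_algebra (space M) X (count_space UNIV)) (indicator {\<omega> \<in> space M. P \<omega>})"

end

(* By exchangeability both rates are n * P(p \<le> t, H = 0) times an expectation over n - 1 pairs:
   E[I(V \<ge> k - 1) / (R + 1)] for the k-FDR and E[1 / (R + 1)] for the FDR. The indicator is
   increasing in the n - 1 independent trials (ordered: no rejection < correct rejection < false
   rejection) and 1 / (R + 1) is decreasing, so by Harris' inequality they are negatively
   correlated. *)
theory Submission
  imports Defs
begin

(* v counts false rejections (probability a), r all rejections (correct ones: probability b). *)
definition trial_step :: "real \<Rightarrow> real \<Rightarrow> (nat \<Rightarrow> nat \<Rightarrow> real) \<Rightarrow> nat \<Rightarrow> nat \<Rightarrow> real" where
  "trial_step a b f v r = (1 - a - b) * f v r + b * f v (Suc r) + a * f (Suc v) (Suc r)"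

text \<open>Expectation of \<open>f\<close> at the counts after \<open>m\<close> independent trials,
  computed by iterating the transition operator on \<open>f\<close> and evaluating at the empty
  counts. No measure is involved, so inductions on \<open>m\<close> only have to generalise over
  \<open>f\<close>.\<close>

fun trial_exp :: "real \<Rightarrow> real \<Rightarrow> nat \<Rightarrow> (nat \<Rightarrow> nat \<Rightarrow> real) \<Rightarrow> real" where
  "trial_exp a b 0 f = f 0 0"
| "trial_exp a b (Suc m) f = trial_exp a b m (trial_step a b f)"

section \<open>Linearity and monotonicity of the trial expectation\<close>

lemma trial_exp_add:
  "trial_exp a b m (\<lambda>v r. f v r + g v r) = trial_exp a b m f + trial_exp a b m g"
proof (induction m arbitrary: f g)
  case (Suc m)
  have "trial_step a b (\<lambda>v r. f v r + g v r)
      = (\<lambda>v r. trial_step a b f v r + trial_step a b g v r)"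
    by (intro ext) (simp add: trial_step_def algebra_simps)
  then show ?case by (simp add: Suc)
qed simp

lemma trial_exp_cmult:
  "trial_exp a b m (\<lambda>v r. c * f v r) = c * trial_exp a b m f"
proof (induction m arbitrary: f)
  case (Suc m)
  have "trial_step a b (\<lambda>v r. c * f v r) = (\<lambda>v r. c * trial_step a b f v r)"
    by (intro ext) (simp add: trial_step_def algebra_simps)
  then show ?case by (simp add: Suc)
qed simp

lemma trial_exp_mono:
  assumes "0 \<le> a" "0 \<le> b" "a + b \<le> 1" and "\<And>v r. f v r \<le> g v r"
  shows "trial_exp a b m f \<le> trial_exp a b m g"
  using assms(4)
proof (induction m arbitrary: f g)
  case (Suc m)
  have "trial_step a b f v r \<le> trial_step a b g v r" for v r
    using assms(1-3) Suc.prems unfolding trial_step_def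
    by (intro add_mono mult_left_mono) auto
  then show ?case using Suc.IH by simp
qed simp

section \<open>Negative correlation and size bias for the trials\<close>

lemma trial_step_mono:
  assumes "0 \<le> a" "0 \<le> b" "a + b \<le> 1" "v \<le> v'" "r \<le> r'"
    and "\<And>v v' r r'. v \<le> v' \<Longrightarrow> r \<le> r' \<Longrightarrow> f v r \<le> f v' r'"
  shows "trial_step a b f v r \<le> trial_step a b f v' r'"
  using assms unfolding trial_step_def by (intro add_mono mult_left_mono) auto

text \<open>Harris' inequality for a single trial: over any pair of outcomes the two functions
  change in opposite directions.\<close>

lemma chebyshev_three_points:
  fixes a b c x y z x' y' z' :: real
  assumes "0 \<le> a" "0 \<le> b" "0 \<le> c" "a + b + c = 1"
    and "x \<le> y" "y \<le> z" "x' \<ge> y'" "y' \<ge> z'"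
  shows "c * (x * x') + b * (y * y') + a * (z * z')
    \<le> (c * x + b * y + a * z) * (c * x' + b * y' + a * z')"
proof -
  \<comment> \<open>The factor \<open>a + b + c\<close>, which equals 1, makes both sides
    homogeneous in the weights, so this is a polynomial identity: the gap is a sum over pairs of
    outcomes.\<close>
  have "(c * x + b * y + a * z) * (c * x' + b * y' + a * z')
      - (a + b + c) * (c * (x * x') + b * (y * y') + a * (z * z'))
      = c * b * ((y - x) * (x' - y')) + b * a * ((z - y) * (y' - z'))
        + c * a * ((z - x) * (x' - z'))"
    by (simp add: algebra_simps)
  moreover have "\<dots> \<ge> 0"
    using assms by (intro add_nonneg_nonneg mult_nonneg_nonneg) auto
  ultimately show ?thesis using assms(4) by simp
qed

text \<open>Condition on all trials but one: the three-point inequality handles that trial, and the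
  conditional means \<open>?T f\<close> and \<open>?T g\<close> are again monotone in opposite
  directions, so the induction hypothesis handles the rest.\<close>

lemma trial_exp_negative_correlation:
  assumes ab: "0 \<le> a" "0 \<le> b" "a + b \<le> 1"
    and f: "\<And>v v' r r'. v \<le> v' \<Longrightarrow> r \<le> r' \<Longrightarrow> f v r \<le> f v' r'"
    and g: "\<And>v v' r r'. v \<le> v' \<Longrightarrow> r \<le> r' \<Longrightarrow> g v' r' \<le> g v r"
  shows "trial_exp a b m (\<lambda>v r. f v r * g v r) \<le> trial_exp a b m f * trial_exp a b m g"
  using f g
proof (induction m arbitrary: f g)
  case (Suc m)
  let ?T = "trial_step a b"
  \<comment> \<open>The count pairs \<open>(v, r)\<close>, \<open>(v, Suc r)\<close>,
    \<open>(Suc v, Suc r)\<close> form an increasing chain, along which \<open>f\<close> ascends and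
    \<open>g\<close> descends.\<close>
  have "?T (\<lambda>v r. f v r * g v r) v r \<le> ?T f v r * ?T g v r" for v r
    unfolding trial_step_def using ab
    by (intro chebyshev_three_points Suc.prems) auto
  then have "trial_exp a b (Suc m) (\<lambda>v r. f v r * g v r)
      \<le> trial_exp a b m (\<lambda>v r. ?T f v r * ?T g v r)"
    using trial_exp_mono[OF ab] by simp
  also have "\<dots> \<le> trial_exp a b m (?T f) * trial_exp a b m (?T g)"
  proof (rule Suc.IH)
    show "?T f v r \<le> ?T f v' r'" if "v \<le> v'" "r \<le> r'" for v v' r r'
      using trial_step_mono[OF ab that Suc.prems(1)] .
    show "?T g v' r' \<le> ?T g v r" if "v \<le> v'" "r \<le> r'" for v v' r r'
      \<comment> \<open>\<open>trial_step\<close> commutes with negation, so the decreasing case is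
        the increasing one for \<open>- g\<close>.\<close>
      using trial_step_mono[OF ab that, of "\<lambda>v r. - g v r"] Suc.prems(2)
      by (simp add: trial_step_def algebra_simps)
  qed
  finally show ?case by simp
qed simp

text \<open>Exchangeability: \<open>v\<close> is a sum of \<open>Suc m\<close> indicators, each
  equal to 1 with probability \<open>a\<close>; given that one of them is 1, the other
  \<open>m\<close> trials are unaffected and both counts are raised by one.\<close>

lemma trial_exp_size_bias:
  "trial_exp a b (Suc m) (\<lambda>v r. real v * f v r)
    = real (Suc m) * a * trial_exp a b m (\<lambda>v r. f (Suc v) (Suc r))"
proof (induction m arbitrary: f)
  case 0
  then show ?case by (simp add: trial_step_def)
next
  case (Suc m)
  \<comment> \<open>The extra term comes from \<open>real (Suc v) = real v + 1\<close>: it is the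
    contribution of the peeled trial itself.\<close>
  have "trial_step a b (\<lambda>v r. real v * f v r)
      = (\<lambda>v r. real v * trial_step a b f v r + a * f (Suc v) (Suc r))"
    by (intro ext) (simp add: trial_step_def algebra_simps)
  then have "trial_exp a b (Suc (Suc m)) (\<lambda>v r. real v * f v r)
      = trial_exp a b (Suc m) (\<lambda>v r. real v * trial_step a b f v r)
        + a * trial_exp a b (Suc m) (\<lambda>v r. f (Suc v) (Suc r))"
    by (simp only: trial_exp.simps(2)[of a b "Suc m"] trial_exp_add trial_exp_cmult)
  \<comment> \<open>Raising both arguments by one commutes with \<open>trial_step\<close>, so the
    step left by the induction hypothesis is absorbed into \<open>Suc m\<close> trials.\<close>
  also have "trial_exp a b (Suc m) (\<lambda>v r. real v * trial_step a b f v r)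
      = real (Suc m) * a * trial_exp a b (Suc m) (\<lambda>v r. f (Suc v) (Suc r))"
    by (subst Suc.IH) (simp add: trial_step_def[abs_def])
  finally show ?case by (simp add: algebra_simps)
qed

section \<open>From the trials to the random pairs\<close>

lemma measurable_sum_nat:
  fixes f :: "'i \<Rightarrow> 'a \<Rightarrow> nat"
  assumes "\<And>i. i \<in> I \<Longrightarrow> f i \<in> measurable M (count_space UNIV)"
  shows "(\<lambda>x. \<Sum>i\<in>I. f i x) \<in> measurable M (count_space UNIV)"
  using assms
proof (induction I rule: infinite_finite_induct)
  case (insert i I)
  have "(\<lambda>x. f i x + k) \<in> measurable M (count_space UNIV)" for k
    by (rule measurable_compose[where g = "\<lambda>j. j + k", OF insert.prems]) simp_all
  then have "(\<lambda>x. f i x + (\<Sum>i\<in>I. f i x)) \<in> measurable M (count_space UNIV)"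
    by (rule measurable_compose_countable[where f = "\<lambda>k x. f i x + k"]) (simp add: insert)
  then show ?case using insert.hyps by simp
qed simp_all

text \<open>\<open>f\<close> may be arbitrary: \<open>X\<close> has countably many values, and
  fixing one leaves a function on a discrete space.\<close>

lemma measurable_of_two_nats:
  fixes X Y :: "'a \<Rightarrow> nat"
  assumes X: "X \<in> measurable M (count_space UNIV)" and Y: "Y \<in> measurable M (count_space UNIV)"
  shows "(\<lambda>\<omega>. f (X \<omega>) (Y \<omega>)) \<in> borel_measurable M"
proof (rule measurable_compose_countable[where f = "\<lambda>v \<omega>. f v (Y \<omega>)", OF _ X])
  show "(\<lambda>\<omega>. f v (Y \<omega>)) \<in> borel_measurable M" for v
    by (rule measurable_compose[OF Y]) simp
qed

text \<open>Induction on \<open>m\<close> with \<open>n\<close> fixed: pair \<open>Suc m\<close> is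
  independent of the earlier pairs, and its three outcomes realise one
  \<open>trial_step\<close>.\<close>

lemma (in prob_space) expectation_V_R:
  fixes ps :: "nat \<Rightarrow> 'a \<Rightarrow> real" and Hs :: "nat \<Rightarrow> 'a \<Rightarrow> nat"
  assumes indep: "indep_vars (\<lambda>_. borel \<Otimes>\<^sub>M count_space UNIV)
      (\<lambda>i \<omega>. (ps i \<omega>, Hs i \<omega>)) {1..n}"
    and a: "\<And>i. i \<in> {1..n} \<Longrightarrow> \<P>(\<omega> in M. ps i \<omega> \<le> t \<and> Hs i \<omega> = 0) = a"
    and b: "\<And>i. i \<in> {1..n} \<Longrightarrow> \<P>(\<omega> in M. ps i \<omega> \<le> t \<and> Hs i \<omega> \<noteq> 0) = b"
    and "m \<le> n"
  shows "expectation (\<lambda>\<omega>. f (V ps Hs m t \<omega>) (R ps m t \<omega>)) = trial_exp a b m f"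
  using \<open>m \<le> n\<close>
proof (induction m arbitrary: f)
  case 0
  then show ?case by (simp add: V_def R_def prob_space)
next
  case (Suc m)
  let ?S = "borel \<Otimes>\<^sub>M count_space UNIV :: (real \<times> nat) measure"
  let ?Y = "\<lambda>i \<omega>. (ps i \<omega>, Hs i \<omega>)"
  define W where "W f \<omega> = f (V ps Hs m t \<omega>) (R ps m t \<omega>)"
    for f :: "nat \<Rightarrow> nat \<Rightarrow> real" and \<omega>
  define X where "X P \<omega> = (of_bool (P (ps (Suc m) \<omega> \<le> t) (Hs (Suc m) \<omega> = 0)) :: real)"
    for P :: "bool \<Rightarrow> bool \<Rightarrow> bool" and \<omega>
  define A where "A P = {\<omega> \<in> space M. P (ps (Suc m) \<omega> \<le> t) (Hs (Suc m) \<omega> = 0)}"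
    for P :: "bool \<Rightarrow> bool \<Rightarrow> bool"
  have Y: "?Y i \<in> measurable M ?S" if "i \<in> {1..n}" for i
    using indep that by (auto simp: indep_vars_def)
  have YS: "?Y (Suc m) \<in> measurable M ?S"
    by (rule Y) (use Suc.prems in auto)
  have [measurable]: "ps (Suc m) \<in> borel_measurable M"
      "Hs (Suc m) \<in> measurable M (count_space UNIV)"
    using measurable_compose[OF YS measurable_fst] measurable_compose[OF YS measurable_snd]
    by simp_all
  have indep': "indep_var (PiM {1..m} (\<lambda>_. ?S)) (\<lambda>\<omega>. \<lambda>i\<in>{1..m}. ?Y i \<omega>)
      (PiM {Suc m} (\<lambda>_. ?S)) (\<lambda>\<omega>. \<lambda>i\<in>{Suc m}. ?Y i \<omega>)"
    using indep by (rule indep_var_restrict) (use Suc.prems in auto)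
  have WX_indep: "indep_var borel (W f) borel (X P)" for f P
  proof -
    \<comment> \<open>\<open>F\<close> and \<open>G\<close> rebuild \<open>W f\<close> and
      \<open>X P\<close> from the two disjoint blocks of pairs, so independence of the blocks passes
      to them.\<close>
    define F where "F x = f (\<Sum>i=1..m. of_bool (fst (x i) \<le> t \<and> snd (x i) = 0))
        (\<Sum>i=1..m. of_bool (fst (x i) \<le> t))" for x :: "nat \<Rightarrow> real \<times> nat"
    define G where "G x = (of_bool (P (fst (x (Suc m)) \<le> t) (snd (x (Suc m)) = 0)) :: real)"
      for x :: "nat \<Rightarrow> real \<times> nat"
    have comp: "(\<lambda>x. h (x i)) \<in> measurable (PiM {1..m} (\<lambda>_. ?S)) (count_space UNIV)"
      if i: "i \<in> {1..m}" and h: "h \<in> measurable ?S (count_space UNIV)"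
      for h :: "real \<times> nat \<Rightarrow> nat" and i
      by (rule measurable_compose[OF _ h]) (rule measurable_component_singleton[OF i])
    have "(\<lambda>x. \<Sum>i=1..m. of_bool (fst (x i) \<le> t \<and> snd (x i) = 0) :: nat)
        \<in> measurable (PiM {1..m} (\<lambda>_. ?S)) (count_space UNIV)"
      by (rule measurable_sum_nat,
          rule comp[of _ "\<lambda>y. of_bool (fst y \<le> t \<and> snd y = 0)"]) measurable
    moreover have "(\<lambda>x. \<Sum>i=1..m. of_bool (fst (x i) \<le> t) :: nat)
        \<in> measurable (PiM {1..m} (\<lambda>_. ?S)) (count_space UNIV)"
      by (rule measurable_sum_nat, rule comp[of _ "\<lambda>y. of_bool (fst y \<le> t)"]) measurable
    ultimately have "F \<in> borel_measurable (PiM {1..m} (\<lambda>_. ?S))"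
      unfolding F_def by (rule measurable_of_two_nats)
    moreover have "G \<in> borel_measurable (PiM {Suc m} (\<lambda>_. ?S))"
      unfolding G_def by measurable
    ultimately have "indep_var borel (F \<circ> (\<lambda>\<omega>. \<lambda>i\<in>{1..m}. ?Y i \<omega>))
        borel (G \<circ> (\<lambda>\<omega>. \<lambda>i\<in>{Suc m}. ?Y i \<omega>))"
      by (rule indep_var_compose[OF indep'])
    also have "F \<circ> (\<lambda>\<omega>. \<lambda>i\<in>{1..m}. ?Y i \<omega>) = W f"
      by (simp add: fun_eq_iff F_def W_def V_def R_def)
    also have "G \<circ> (\<lambda>\<omega>. \<lambda>i\<in>{Suc m}. ?Y i \<omega>) = X P"
      by (simp add: fun_eq_iff G_def X_def)
    finally show ?thesis .
  qed
  have W_int: "integrable M (W f)" for f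
  proof (rule integrable_const_bound)
    show "W f \<in> borel_measurable M"
      using WX_indep[THEN indep_var_rv1] by simp
    have count_le: "(\<Sum>i=1..m. of_bool (Q i) :: nat) \<le> m" for Q
      using sum_bounded_above[of "{1..m}" "\<lambda>i. of_bool (Q i) :: nat" 1] by simp
    \<comment> \<open>Both counts are at most \<open>m\<close>, so \<open>W f\<close> takes its
      values on a finite grid and is bounded for every \<open>f\<close>.\<close>
    have "norm (W f \<omega>) \<le> Max ((\<lambda>(i, j). norm (f i j)) ` ({..m} \<times> {..m}))" for \<omega>
      unfolding W_def V_def R_def using count_le
      by (intro Max_ge image_eqI[of _ _ "(\<Sum>i=1..m. of_bool (ps i \<omega> \<le> t \<and> Hs i \<omega> = 0),
          \<Sum>i=1..m. of_bool (ps i \<omega> \<le> t))"]) auto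
    then show "AE \<omega> in M. norm (W f \<omega>) \<le> Max ((\<lambda>(i, j). norm (f i j)) ` ({..m} \<times> {..m}))"
      by simp
  qed
  have X_eq: "X P \<omega> = indicator (A P) \<omega>" if "\<omega> \<in> space M" for P \<omega>
    using that by (simp add: X_def A_def)
  have A_sets [measurable]: "A P \<in> sets M" for P
    unfolding A_def by measurable
  have X_int: "integrable M (X P)" for P
    by (subst Bochner_Integration.integrable_cong[OF refl X_eq]) (auto simp: less_top[symmetric])
  have X_exp: "expectation (X P) = prob (A P)" for P
    by (subst Bochner_Integration.integral_cong[OF refl X_eq]) auto
  note WX = indep_var_lebesgue_integral[OF WX_indep W_int X_int]
    indep_var_integrable[OF WX_indep W_int X_int]
  \<comment> \<open>The arguments say whether the last hypothesis is rejected and whether it is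
    true: \<open>?a\<close> is a false rejection, \<open>?b\<close> a correct one, \<open>?c\<close>
    no rejection.\<close>
  let ?a = "\<lambda>p h. p \<and> h" and ?b = "\<lambda>p h. p \<and> \<not> h" and ?c = "\<lambda>p h :: bool. \<not> p"
  have "prob (A ?a) = a" "prob (A ?b) = b"
    using a[of "Suc m"] b[of "Suc m"] Suc.prems by (simp_all add: A_def)
  moreover have "prob (A ?a) + prob (A ?b) + prob (A ?c) = 1"
  proof -
    have "X ?a \<omega> + X ?b \<omega> + X ?c \<omega> = 1" for \<omega>
      by (auto simp: X_def)
    then have "expectation (\<lambda>\<omega>. X ?a \<omega> + X ?b \<omega> + X ?c \<omega>) = 1"
      by (simp add: prob_space)
    then show ?thesis by (simp add: X_int X_exp)
  qed
  ultimately have probs: "prob (A ?a) = a" "prob (A ?b) = b" "prob (A ?c) = 1 - a - b"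
    by auto
  have W_exp: "expectation (W f) = trial_exp a b m f" for f
    unfolding W_def using Suc.prems by (intro Suc.IH) simp
  \<comment> \<open>Exactly one of the three indicators is 1, and it selects the matching update of
    the counts.\<close>
  have "f (V ps Hs (Suc m) t \<omega>) (R ps (Suc m) t \<omega>)
      = W f \<omega> * X ?c \<omega> + W (\<lambda>v r. f v (Suc r)) \<omega> * X ?b \<omega>
        + W (\<lambda>v r. f (Suc v) (Suc r)) \<omega> * X ?a \<omega>" for \<omega>
    by (auto simp: W_def X_def V_def R_def)
  then have "expectation (\<lambda>\<omega>. f (V ps Hs (Suc m) t \<omega>) (R ps (Suc m) t \<omega>))
      = expectation (W f) * (1 - a - b) + expectation (W (\<lambda>v r. f v (Suc r))) * b
        + expectation (W (\<lambda>v r. f (Suc v) (Suc r))) * a"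
    by (simp add: WX X_exp probs)
  also have "\<dots> = trial_exp a b m (trial_step a b f)"
    by (simp add: W_exp trial_step_def[abs_def] trial_exp_add trial_exp_cmult)
  finally show ?case by simp
qed

theorem mainTheorem2:
  fixes M :: "'a measure" and N :: "'b measure"
    and ps :: "nat \<Rightarrow> 'a \<Rightarrow> real" and Hs :: "nat \<Rightarrow> 'a \<Rightarrow> nat"
    and p :: "'b \<Rightarrow> real" and H :: "'b \<Rightarrow> nat"
    and F1 :: "real \<Rightarrow> real" and \<pi>0 t :: real and k n :: nat
  assumes "1 \<le> k" and "k \<le> n" and "0 < t" and "t < 1"
    and "prob_space N"
    and "p \<in> borel_measurable N" and "H \<in> measurable N (count_space UNIV)"
    and "\<forall>\<omega>\<in>space N. p \<omega> \<in> {0..1}" and "\<forall>\<omega>\<in>space N. H \<omega> \<in> {0, 1}"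
    and "\<P>(\<omega> in N. H \<omega> = 0) = \<pi>0" and "\<pi>0 = 1 - \<P>(\<omega> in N. H \<omega> = 1)"
    and "\<exists>D. real_distribution D \<and> F1 = cdf D"
    and "\<forall>u\<in>{0<..<1}. AE \<omega> in N. cond_prob_given N H (\<lambda>\<omega>'. p \<omega>' \<le> u) \<omega>
           = (1 - real (H \<omega>)) * u + real (H \<omega>) * F1 u"
    and "prob_space M"
    and "\<forall>i\<in>{1..n}. \<forall>\<omega>\<in>space M. ps i \<omega> \<in> {0..1} \<and> Hs i \<omega> \<in> {0, 1}"
    and "prob_space.indep_vars M (\<lambda>_. borel \<Otimes>\<^sub>M count_space UNIV)
           (\<lambda>i \<omega>. (ps i \<omega>, Hs i \<omega>)) {1..n}"
    and "\<forall>i\<in>{1..n}. distr M (borel \<Otimes>\<^sub>M count_space UNIV) (\<lambda>\<omega>. (ps i \<omega>, Hs i \<omega>))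
           = distr N (borel \<Otimes>\<^sub>M count_space UNIV) (\<lambda>\<omega>. (p \<omega>, H \<omega>))"
  shows "kFDR M ps Hs k n t \<le> \<P>(\<omega> in M. V ps Hs (n - 1) t \<omega> \<ge> k - 1) * FDR M ps Hs n t"
proof -
  interpret prob_space M by fact
  note [measurable] = assms(6,7)
  note indep = assms(16) and law = assms(17)
  let ?S = "borel \<Otimes>\<^sub>M count_space UNIV :: (real \<times> nat) measure"
  define a where "a = measure N {\<omega> \<in> space N. p \<omega> \<le> t \<and> H \<omega> = 0}"
  define b where "b = measure N {\<omega> \<in> space N. p \<omega> \<le> t \<and> H \<omega> \<noteq> 0}"
  have transfer: "\<P>(\<omega> in M. Q (ps i \<omega>) (Hs i \<omega>)) = \<P>(\<omega> in N. Q (p \<omega>) (H \<omega>))"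
    if i: "i \<in> {1..n}" and [measurable]: "Measurable.pred ?S (\<lambda>(x, h). Q x h)" for i Q
  proof -
    have Y: "(\<lambda>\<omega>. (ps i \<omega>, Hs i \<omega>)) \<in> measurable M ?S"
      using indep i by (auto simp: indep_vars_def)
    have Z: "(\<lambda>\<omega>. (p \<omega>, H \<omega>)) \<in> measurable N ?S" by measurable
    have B: "{(x, h). Q x h} \<in> sets ?S"
      using that(2) by (simp add: pred_def space_pair_measure split_def)
    \<comment> \<open>Equality of the laws is evaluated at the set of pairs satisfying
      \<open>Q\<close>.\<close>
    have "measure (distr M ?S (\<lambda>\<omega>. (ps i \<omega>, Hs i \<omega>))) {(x, h). Q x h}
        = measure (distr N ?S (\<lambda>\<omega>. (p \<omega>, H \<omega>))) {(x, h). Q x h}"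
      using law i by simp
    then show ?thesis
      by (simp add: measure_distr[OF Y B] measure_distr[OF Z B] vimage_def Int_def conj_commute)
  qed
  have E: "expectation (\<lambda>\<omega>. f (V ps Hs m t \<omega>) (R ps m t \<omega>)) = trial_exp a b m f"
    if "m \<le> n" for m f
    unfolding a_def b_def using that
    by (intro expectation_V_R[OF indep] transfer) simp_all
  interpret N: prob_space N by fact
  have ab: "0 \<le> a" "0 \<le> b" "a + b \<le> 1"
  proof -
    have "a + b = measure N ({\<omega> \<in> space N. p \<omega> \<le> t \<and> H \<omega> = 0} \<union> {\<omega> \<in> space N. p \<omega> \<le> t \<and> H \<omega> \<noteq> 0})"
      unfolding a_def b_def by (rule N.finite_measure_Union[symmetric]) auto
    then show "a + b \<le> 1" by simp
  qed (simp_all add: a_def b_def)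
  obtain m where n: "n = Suc m" using assms(1,2) by (cases n) auto
  \<comment> \<open>One false rejection is set aside by the size bias. Hence the threshold drops to
    \<open>k - 1\<close>, and the denominator \<open>max r 1\<close> becomes \<open>Suc r\<close>,
    which is already positive.\<close>
  define f where "f v r = (of_bool (k - 1 \<le> v) :: real)" for v r :: nat
  define g where "g v r = 1 / real (Suc r)" for v r :: nat
  have max_Suc: "max (Suc r) 1 = Suc r" for r by simp
  have "kFDR M ps Hs k n t
      = trial_exp a b (Suc m) (\<lambda>v r. real v * (of_bool (k \<le> v) / real (max r 1)))"
    unfolding kFDR_def using E[of n "\<lambda>v r. real v * (of_bool (k \<le> v) / real (max r 1))"]
    by (simp add: n)
  also have "\<dots> = real n * a * trial_exp a b m (\<lambda>v r. f v r * g v r)"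
    using \<open>1 \<le> k\<close> unfolding trial_exp_size_bias
    by (simp add: n f_def g_def le_diff_conv max_Suc)
  \<comment> \<open>\<open>f\<close> increases with \<open>v\<close> and ignores \<open>r\<close>;
    \<open>g\<close> decreases with \<open>r\<close> and ignores \<open>v\<close>.\<close>
  also have "\<dots> \<le> real n * a * (trial_exp a b m f * trial_exp a b m g)"
    by (intro mult_left_mono trial_exp_negative_correlation ab)
      (auto simp: f_def g_def ab frac_le)
  also have "trial_exp a b m f = \<P>(\<omega> in M. V ps Hs (n - 1) t \<omega> \<ge> k - 1)"
  proof -
    have "trial_exp a b m f = expectation (\<lambda>\<omega>. of_bool (k - 1 \<le> V ps Hs m t \<omega>))"
      using E[of m f] by (simp add: n f_def)
    also have "\<dots> = expectation (indicator {\<omega> \<in> space M. k - 1 \<le> V ps Hs m t \<omega>})"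
      by (rule Bochner_Integration.integral_cong) simp_all
    also have "\<dots> = \<P>(\<omega> in M. k - 1 \<le> V ps Hs m t \<omega>)"
      by (simp add: Int_def conj_commute)
    finally show ?thesis by (simp add: n)
  qed
  also have "real n * a * (\<P>(\<omega> in M. V ps Hs (n - 1) t \<omega> \<ge> k - 1) * trial_exp a b m g)
      = \<P>(\<omega> in M. V ps Hs (n - 1) t \<omega> \<ge> k - 1) * (real n * a * trial_exp a b m g)"
    by simp
  \<comment> \<open>The size-bias identity read backwards, now without the indicator, recovers the
    FDR.\<close>
  also have "real n * a * trial_exp a b m g
      = trial_exp a b (Suc m) (\<lambda>v r. real v * (1 / real (max r 1)))"
    unfolding trial_exp_size_bias by (simp add: n g_def[abs_def] max_Suc)
  also have "\<dots> = FDR M ps Hs n t"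
    unfolding FDR_def using E[of n "\<lambda>v r. real v * (1 / real (max r 1))"] by (simp add: n)
  finally show ?thesis .
qed

end
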